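(* Let $d\ge 1$. There exists a compact set $X\in\mathcal{K}$ such that $\mathrm{Tan}(X,x)\approx\mathcal{K}$ for all $x\in X$.
   Context: $Q=[-1,1]^d\subset\mathbb{R}^d$ and $\mathcal{K}$ is the collection of all non-empty compact subsets of $Q$ with the Hausdorff metric $d_H$. For $E\in\mathcal{K}$, $x\in E$, $t>0$, put $T_{x,t}(E)=\{(y-x)/t:y\in E\}\cap Q$. A set $F\in\mathcal{K}$ is a tangent set of $E$ at $x\in E$ if there is a sequence $t_n\searrow 0$ with $d_H(T_{x,t_n}(E),F)\to 0$; $\mathrm{Tan}(E,x)$ is the collection of all tangent sets of $E$ at $x$. For sub-collections $\mathcal{A},\mathcal{B}\subset\mathcal{K}$ write $\mathcal{A}\lesssim\mathcal{B}$ if there is $\lambda_0>0$ such that for every $A\in\mathcal{A}$ there are $B\in\mathcal{B}$, a real number $\lambda$ with $\lambda_0<\lambda<\lambda_0^{-1}$, and vectors $a\in A$, $b\in B$ with $\lambda(A-a)=B-b$. Write $\mathcal{A}\approx\mathcal{B}$ if $\mathcal{A}\lesssim\mathcal{B}$ and $\mathcal{B}\lesssim\mathcal{A}$. *)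

theory Defs
  imports "HOL-Analysis.Analysis"
begin

text \<open>On \<open>real ^ 'n\<close> the numeral \<open>1\<close> is the all-ones vector, so this is \<open>[-1,1]^d\<close>.\<close>

definition cube :: "(real ^ 'n) set" where
  "cube = cbox (- 1) 1"

definition cube_compacts :: "(real ^ 'n) set set" where
  "cube_compacts = {E. E \<noteq> {} \<and> compact E \<and> E \<subseteq> cube}"

text \<open>Only meaningful for nonempty bounded sets: \<open>Sup\<close> on the reals and \<open>infdist\<close> take junk
  values on unbounded, respectively empty, sets.\<close>

definition hausdorff_dist :: "'a::metric_space set \<Rightarrow> 'a set \<Rightarrow> real" where
  "hausdorff_dist A B = max (SUP x\<in>A. infdist x B) (SUP y\<in>B. infdist y A)"

definition magnify :: "real ^ 'n \<Rightarrow> real \<Rightarrow> (real ^ 'n) set \<Rightarrow> (real ^ 'n) set" where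
  "magnify x t E = (\<lambda>y. (y - x) /\<^sub>R t) ` E \<inter> cube"

definition Tan :: "(real ^ 'n) set \<Rightarrow> real ^ 'n \<Rightarrow> (real ^ 'n) set set" where
  "Tan E x = {F \<in> cube_compacts. \<exists>t :: nat \<Rightarrow> real.
     (\<forall>n. t n > 0) \<and> decseq t \<and> t \<longlonglongrightarrow> 0 \<and>
     (\<lambda>n. hausdorff_dist (magnify x (t n) E) F) \<longlonglongrightarrow> 0}"

definition sim_le :: "(real ^ 'n) set set \<Rightarrow> (real ^ 'n) set set \<Rightarrow> bool" where
  "sim_le \<A> \<B> \<longleftrightarrow> (\<exists>c>0. \<forall>A\<in>\<A>. \<exists>B\<in>\<B>. \<exists>l. c < l \<and> l < inverse c \<and>
     (\<exists>a\<in>A. \<exists>b\<in>B. (\<lambda>z. l *\<^sub>R (z - a)) ` A = (\<lambda>z. z - b) ` B))"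

definition sim_eq :: "(real ^ 'n) set set \<Rightarrow> (real ^ 'n) set set \<Rightarrow> bool" where
  "sim_eq \<A> \<B> \<longleftrightarrow> sim_le \<A> \<B> \<and> sim_le \<B> \<A>"

end

theory Submission
  imports Defs
begin

text \<open>
  Let \<open>K n\<close> run through the finite nonempty subsets of a countable dense subset of the cube, each
  occurring infinitely often, and let \<open>X\<close> consist of all sums \<open>\<Sum>n. r n *\<^sub>R k n\<close> with \<open>k n \<in> K n\<close>, where
  \<open>r\<close> decreases so fast that \<open>r (Suc n) / r n\<close> is negligible against the gaps of \<open>K n\<close>. Seen from
  the point with digits \<open>k\<close> at scale \<open>3 * r m\<close>, earlier digits push everything else out of the cube
  and later digits are invisible, so the magnification is almost \<open>(K m - k m) / 3\<close>. If \<open>K m\<close>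
  converges to \<open>E\<close> and \<open>k m\<close> to \<open>a\<close> along a subsequence, \<open>(E - a) / 3\<close> is a tangent set.
\<close>

section \<open>Hausdorff closeness, the cube and finite approximation\<close>

text \<open>A pointwise form of Hausdorff closeness: errors add under composition and no supremum is
  involved. The passage to \<open>hausdorff_dist\<close> is made once, where nonemptiness and the
  bound \<open>e\<close> rule out default values.\<close>

definition hausdorff_near :: "real \<Rightarrow> 'a::metric_space set \<Rightarrow> 'a set \<Rightarrow> bool" where
  "hausdorff_near e A B \<longleftrightarrow> (\<forall>a\<in>A. \<exists>b\<in>B. dist a b \<le> e) \<and> (\<forall>b\<in>B. \<exists>a\<in>A. dist a b \<le> e)"

lemma hausdorff_near_trans:
  assumes "hausdorff_near e A B" "hausdorff_near e' B C"
  shows "hausdorff_near (e + e') A C"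
  using assms unfolding hausdorff_near_def
  by (meson add_mono dist_triangle order_trans)

lemma hausdorff_near_image:
  assumes "\<And>x. x \<in> A \<Longrightarrow> dist (f x) (g x) \<le> e"
  shows "hausdorff_near e (f ` A) (g ` A)"
  using assms unfolding hausdorff_near_def by blast

lemma hausdorff_near_scale:
  fixes A B :: "'a::real_normed_vector set"
  assumes "hausdorff_near e A B"
  shows "hausdorff_near (\<bar>c\<bar> * e) ((\<lambda>z. c *\<^sub>R (z - a)) ` A) ((\<lambda>z. c *\<^sub>R (z - a)) ` B)"
proof -
  have "dist (c *\<^sub>R (x - a)) (c *\<^sub>R (y - a)) \<le> \<bar>c\<bar> * e" if "dist x y \<le> e" for x y
  proof -
    have "dist (c *\<^sub>R (x - a)) (c *\<^sub>R (y - a)) = \<bar>c\<bar> * dist x y"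
      by (simp add: dist_norm flip: scaleR_diff_right)
    with that show ?thesis by (simp add: mult_left_mono)
  qed
  with assms show ?thesis
    unfolding hausdorff_near_def by blast
qed

lemma hausdorff_dist_near:
  assumes near: "hausdorff_near e A B" and "A \<noteq> {}" "B \<noteq> {}"
  shows "0 \<le> hausdorff_dist A B" "hausdorff_dist A B \<le> e"
proof -
  have A: "infdist x B \<le> e" if "x \<in> A" for x
    using near that unfolding hausdorff_near_def by (meson infdist_le2)
  have B: "infdist y A \<le> e" if "y \<in> B" for y
    using near that unfolding hausdorff_near_def by (metis dist_commute infdist_le2)
  show "hausdorff_dist A B \<le> e"
    unfolding hausdorff_dist_def using A B assms(2,3) by (auto intro!: cSUP_least)
  obtain x where "x \<in> A" using \<open>A \<noteq> {}\<close> by blast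
  moreover have "bdd_above ((\<lambda>x. infdist x B) ` A)" using A by (rule bdd_aboveI2)
  ultimately have "infdist x B \<le> (SUP x\<in>A. infdist x B)" by (rule cSUP_upper)
  then show "0 \<le> hausdorff_dist A B"
    unfolding hausdorff_dist_def using infdist_nonneg[of x B] by linarith
qed

lemma norm_cube_le:
  fixes x :: "real ^ 'n"
  assumes "x \<in> cube"
  shows "norm x \<le> real CARD('n)"
proof -
  have "\<bar>x $ i\<bar> \<le> 1" for i
    using assms by (auto simp: cube_def mem_box_cart abs_le_iff minus_le_iff)
  then have "(\<Sum>i\<in>UNIV. \<bar>x $ i\<bar>) \<le> (\<Sum>i\<in>(UNIV :: 'n set). 1)"
    by (intro sum_mono)
  then show ?thesis using norm_le_l1_cart[of x] by simp
qed

lemma mem_cubeI: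
  fixes x :: "real ^ 'n"
  assumes "\<And>i. \<bar>x $ i\<bar> \<le> 1"
  shows "x \<in> cube"
  using assms by (auto simp: cube_def mem_box_cart abs_le_iff minus_le_iff)

lemma abs_component_cube_le:
  fixes x :: "real ^ 'n"
  assumes "x \<in> cube"
  shows "\<bar>x $ i\<bar> \<le> 1"
  using assms by (auto simp: cube_def mem_box_cart abs_le_iff minus_le_iff)

text \<open>Compactness of \<open>E\<close> yields finitely many centres in \<open>T\<close> whose
  balls cover \<open>E\<close>; those far from \<open>E\<close> must still be discarded.\<close>

lemma finite_hausdorff_approx:
  assumes "compact E" "E \<subseteq> closure T" "E \<noteq> {}" "e > 0"
  obtains F where "finite F" "F \<subseteq> T" "F \<noteq> {}" "hausdorff_near e F E"
proof -
  have "E \<subseteq> (\<Union>t\<in>T. ball t e)"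
    using assms(2,4) by (force simp: closure_approachable)
  then obtain C where C: "C \<subseteq> T" "finite C" "E \<subseteq> (\<Union>t\<in>C. ball t e)"
    using compactE_image[OF assms(1), of T "\<lambda>t. ball t e"] by (metis open_ball)
  \<comment> \<open>Covering gives only one half of closeness; this selection gives the other and
    loses no ball that meets \<open>E\<close>.\<close>
  define F where "F = {t\<in>C. \<exists>x\<in>E. dist t x \<le> e}"
  have "hausdorff_near e F E"
    unfolding hausdorff_near_def F_def using C(3) by (force simp: subset_iff)
  moreover from this have "F \<noteq> {}"
    using assms(3) unfolding hausdorff_near_def by blast
  ultimately show thesis using C that[of F] by (auto simp: F_def)
qed

lemma strict_mono_choice:
  assumes "\<And>j N. \<exists>n\<ge>N. P j n"
  obtains m :: "nat \<Rightarrow> nat" where "strict_mono m" "\<And>j. P j (m j)"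
proof -
  have "\<exists>m. \<forall>j. P j (m j) \<and> m j < m (Suc j)"
    using assms by (intro dependent_nat_choice) (meson less_eq_Suc_le)+
  then show thesis using that by (auto simp: strict_mono_Suc_iff)
qed

section \<open>Sums over rapidly decreasing digit scales\<close>

text \<open>\<open>CARD('n)\<close> bounds the norm on the cube. \<open>r_0\<close> keeps all sums
  inside the cube, \<open>r_Suc\<close> makes the digits after \<open>n\<close> negligible relative
  to \<open>r n\<close>, and \<open>r_gap\<close> makes a difference in digit \<open>n\<close> twice
  as large as anything later digits can compensate.\<close>

locale fast_digits =
  fixes K :: "nat \<Rightarrow> (real ^ 'n) set" and r :: "nat \<Rightarrow> real"
  assumes K_subset: "K n \<subseteq> cube" and K_finite: "finite (K n)" and K_nonempty: "K n \<noteq> {}"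
    and r_pos: "r n > 0" and r_0: "2 * real CARD('n) * r 0 \<le> 1"
    and r_Suc: "4 * real CARD('n) * real (Suc n) * r (Suc n) \<le> r n"
    and r_gap: "\<lbrakk>a \<in> K n; b \<in> K n; a \<noteq> b\<rbrakk> \<Longrightarrow> 8 * real CARD('n) * r (Suc n) \<le> r n * norm (a - b)"
begin

definition pt :: "(nat \<Rightarrow> real ^ 'n) \<Rightarrow> real ^ 'n" where
  "pt k = (\<Sum>n. r n *\<^sub>R k n)"

definition X :: "(real ^ 'n) set" where
  "X = pt ` PiE UNIV K"

lemma card_ge_1: "1 \<le> real CARD('n)"
  by (simp add: Suc_leI)

lemma r_half: "2 * r (Suc n) \<le> r n"
proof -
  have "2 * r (Suc n) \<le> (4 * real CARD('n) * real (Suc n)) * r (Suc n)"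
  proof (rule mult_right_mono)
    have "1 * 1 \<le> real CARD('n) * real (Suc n)"
      using card_ge_1 by (intro mult_mono) auto
    then show "2 \<le> 4 * real CARD('n) * real (Suc n)" by linarith
  qed (use r_pos[of "Suc n"] in simp)
  then show ?thesis using r_Suc[of n] by linarith
qed

lemma r_geometric: "r (n + q) \<le> r q * (1/2) ^ n"
proof (induction n)
  case (Suc n)
  then show ?case using r_half[of "n + q"] by simp
qed simp

lemma r_decseq: "decseq r"
proof (rule decseq_SucI)
  show "r (Suc n) \<le> r n" for n using r_half[of n] r_pos[of "Suc n"] by linarith
qed

lemma r_tendsto: "r \<longlonglongrightarrow> 0"
proof (rule tendsto_sandwich)
  show "\<forall>\<^sub>F n in sequentially. 0 \<le> r n" using r_pos by (simp add: less_imp_le)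
  show "\<forall>\<^sub>F n in sequentially. r n \<le> r 0 * (1/2) ^ n" using r_geometric[of _ 0] by simp
  show "(\<lambda>n. r 0 * (1/2) ^ n) \<longlonglongrightarrow> 0"
    by (intro tendsto_mult_right_zero LIMSEQ_power_zero) simp
qed simp

text \<open>Halving of the scales dominates the tail from \<open>q\<close> by a geometric series
  with first term \<open>r q * C\<close>, whence the factor 2.\<close>

lemma tail_bound:
  fixes v :: "nat \<Rightarrow> real ^ 'n"
  assumes "\<And>n. norm (v n) \<le> C"
  shows "summable (\<lambda>n. r n *\<^sub>R v n)" and "norm (\<Sum>n. r (n + q) *\<^sub>R v (n + q)) \<le> 2 * C * r q"
proof -
  have C: "0 \<le> C" using assms[of 0] norm_ge_zero order_trans by blast
  have le: "norm (r (n + q) *\<^sub>R v (n + q)) \<le> r q * C * (1/2) ^ n" for n q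
  proof -
    have "r (n + q) * norm (v (n + q)) \<le> (r q * (1/2) ^ n) * C"
      using r_geometric[of n q] assms C r_pos[of q] by (intro mult_mono) auto
    then show ?thesis using r_pos[of "n + q"] by (simp add: mult_ac)
  qed
  have geo: "(\<lambda>n. r q * C * (1/2) ^ n) sums (r q * C * 2)" for q
    using sums_mult[OF geometric_sums[of "1/2::real"], of "r q * C"] by simp
  show "summable (\<lambda>n. r n *\<^sub>R v n)"
    using le[of _ 0] geo[of 0] by (intro summable_comparison_test[OF _ sums_summable[OF geo[of 0]]]) auto
  have s: "summable (\<lambda>n. norm (r (n + q) *\<^sub>R v (n + q)))"
    using le by (intro summable_comparison_test[OF _ sums_summable[OF geo[of q]]]) auto
  have "norm (\<Sum>n. r (n + q) *\<^sub>R v (n + q)) \<le> (\<Sum>n. norm (r (n + q) *\<^sub>R v (n + q)))"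
    using s by (rule summable_norm)
  also have "\<dots> \<le> (\<Sum>n. r q * C * (1/2) ^ n)"
    using le s sums_summable[OF geo] by (intro suminf_le)
  also have "\<dots> = r q * C * 2" using geo sums_unique by metis
  finally show "norm (\<Sum>n. r (n + q) *\<^sub>R v (n + q)) \<le> 2 * C * r q" by (simp add: mult_ac)
qed

lemma digit_norm:
  assumes "k \<in> PiE UNIV K"
  shows "norm (k n) \<le> real CARD('n)"
  using assms K_subset[of n] norm_cube_le by (auto simp: PiE_iff)

text \<open>Digits before \<open>m\<close> cancel and digit \<open>m\<close> is the main term. Digit
  differences have norm at most \<open>2 * CARD('n)\<close>, and the tail bound doubles this to
  4.\<close>

lemma pt_diff:
  assumes k: "k \<in> PiE UNIV K" and k': "k' \<in> PiE UNIV K" and agree: "\<And>n. n < m \<Longrightarrow> k n = k' n"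
  shows "norm (pt k' - pt k - r m *\<^sub>R (k' m - k m)) \<le> 4 * real CARD('n) * r (Suc m)"
proof -
  define v where "v n = k' n - k n" for n
  have v: "norm (v n) \<le> 2 * real CARD('n)" for n
    unfolding v_def using norm_triangle_ineq4[of "k' n" "k n"] digit_norm[OF k, of n] digit_norm[OF k', of n]
    by linarith
  have "pt k' - pt k = (\<Sum>n. r n *\<^sub>R v n)"
    unfolding pt_def v_def scaleR_diff_right
    by (intro suminf_diff tail_bound(1)[OF digit_norm] k k')
  also have "\<dots> = (\<Sum>n. r (n + Suc m) *\<^sub>R v (n + Suc m)) + (\<Sum>i<Suc m. r i *\<^sub>R v i)"
    by (rule suminf_split_initial_segment[OF tail_bound(1)[OF v]])
  also have "(\<Sum>i<Suc m. r i *\<^sub>R v i) = r m *\<^sub>R v m"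
    using agree by (simp add: v_def)
  finally show ?thesis using tail_bound(2)[OF v, of "Suc m"] by (simp add: v_def)
qed

text \<open>The radius is what the cube can see at scale \<open>3 * r m\<close>. If the first
  differing digit \<open>p\<close> came before \<open>m\<close>, the gap at \<open>p\<close> minus
  the tail would leave at least \<open>4 * CARD('n) * r (Suc p)\<close>, which exceeds that
  radius.\<close>

lemma digits_agree:
  assumes k: "k \<in> PiE UNIV K" and k': "k' \<in> PiE UNIV K"
    and close: "norm (pt k' - pt k) \<le> 3 * real CARD('n) * r m" and "n < m"
  shows "k n = k' n"
proof (rule ccontr)
  assume "k n \<noteq> k' n"
  define p where "p = (LEAST p. k p \<noteq> k' p)"
  have p: "k p \<noteq> k' p" "p \<le> n"
    unfolding p_def using \<open>k n \<noteq> k' n\<close> by (rule LeastI, rule Least_le)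
  have agree: "k q = k' q" if "q < p" for q
    using not_less_Least[OF that[unfolded p_def]] by simp
  have "8 * real CARD('n) * r (Suc p) \<le> r p * norm (k' p - k p)"
    using k k' p(1) by (intro r_gap) auto
  also have "\<dots> = norm (r p *\<^sub>R (k' p - k p))"
    using r_pos[of p] by simp
  also have "\<dots> \<le> norm (pt k' - pt k) + norm (pt k' - pt k - r p *\<^sub>R (k' p - k p))"
    using norm_triangle_sub norm_minus_commute by metis
  also have "\<dots> \<le> 3 * real CARD('n) * r m + 4 * real CARD('n) * r (Suc p)"
    using close pt_diff[OF k k' agree] by (intro add_mono) auto
  \<comment> \<open>Since \<open>p < m\<close>, monotonicity gives
    \<open>r m \<le> r (Suc p)\<close>; the total 7 stays below the 8 of the gap condition.\<close>
  also have "\<dots> \<le> 7 * real CARD('n) * r (Suc p)"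
    using decseqD[OF r_decseq, of "Suc p" m] p(2) \<open>n < m\<close> by simp
  finally show False using r_pos[of "Suc p"] card_ge_1 by simp
qed

lemma pt_diff_scaled:
  assumes "k \<in> PiE UNIV K" "k' \<in> PiE UNIV K" "\<And>n. n < m \<Longrightarrow> k n = k' n"
  shows "norm ((pt k' - pt k) /\<^sub>R (3 * r m) - (1/3) *\<^sub>R (k' m - k m)) \<le> 1 / (3 * real (Suc m))"
proof -
  have "norm (pt k' - pt k - r m *\<^sub>R (k' m - k m)) * Suc m \<le> (4 * real CARD('n) * r (Suc m)) * Suc m"
    using pt_diff[OF assms] by (intro mult_right_mono) auto
  also have "\<dots> \<le> r m"
    using r_Suc[of m] by (simp add: mult_ac)
  finally have le: "norm (pt k' - pt k - r m *\<^sub>R (k' m - k m)) \<le> r m / Suc m"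
    by (simp add: pos_le_divide_eq)
  have "(pt k' - pt k) /\<^sub>R (3 * r m) - (1/3) *\<^sub>R (k' m - k m)
      = (pt k' - pt k - r m *\<^sub>R (k' m - k m)) /\<^sub>R (3 * r m)"
    using r_pos[of m] by (subst scaleR_diff_right[of _ "pt k' - pt k"]) simp
  then have "norm ((pt k' - pt k) /\<^sub>R (3 * r m) - (1/3) *\<^sub>R (k' m - k m))
      = \<bar>inverse (3 * r m)\<bar> * norm (pt k' - pt k - r m *\<^sub>R (k' m - k m))"
    by (simp only: norm_scaleR)
  also have "\<dots> = norm (pt k' - pt k - r m *\<^sub>R (k' m - k m)) / (3 * r m)"
    using r_pos[of m] by (simp add: divide_simps)
  also have "\<dots> \<le> (r m / Suc m) / (3 * r m)"
    using le r_pos[of m] by (intro divide_right_mono) auto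
  also have "\<dots> = 1 / (3 * real (Suc m))"
    using r_pos[of m] by simp
  finally show ?thesis .
qed

text \<open>The factor 3 leaves room: differences of cube points have coordinates at most 2, so
  after scaling at most \<open>2/3\<close>, and the error of at most \<open>1/3\<close> cannot push
  a point out of the cube. Hence the intersection in \<open>magnify\<close> cuts off no part of the
  copy of \<open>K m\<close>.\<close>

lemma magnify_near:
  assumes k: "k \<in> PiE UNIV K"
  shows "hausdorff_near (1 / (3 * real (Suc m))) (magnify (pt k) (3 * r m) X)
    ((\<lambda>z. (1/3) *\<^sub>R (z - k m)) ` K m)"
  unfolding hausdorff_near_def
proof (intro conjI ballI)
  fix u assume "u \<in> magnify (pt k) (3 * r m) X"
  then obtain k' where k': "k' \<in> PiE UNIV K" and u: "u = (pt k' - pt k) /\<^sub>R (3 * r m)" "u \<in> cube"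
    by (auto simp: magnify_def X_def)
  have "norm (pt k' - pt k) = norm u * (3 * r m)"
    using r_pos[of m] by (simp add: u(1))
  also have "\<dots> \<le> real CARD('n) * (3 * r m)"
    using norm_cube_le[OF u(2)] r_pos[of m] by (intro mult_right_mono) auto
  finally have "k n = k' n" if "n < m" for n
    using digits_agree[OF k k' _ that] by (simp add: mult_ac)
  from pt_diff_scaled[OF k k' this] have "dist u ((1/3) *\<^sub>R (k' m - k m)) \<le> 1 / (3 * real (Suc m))"
    by (simp add: u(1) dist_norm)
  then show "\<exists>b\<in>(\<lambda>z. (1/3) *\<^sub>R (z - k m)) ` K m. dist u b \<le> 1 / (3 * real (Suc m))"
    using k' by (auto simp: PiE_iff)
next
  fix b assume "b \<in> (\<lambda>z. (1/3) *\<^sub>R (z - k m)) ` K m"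
  then obtain z where z: "z \<in> K m" "b = (1/3) *\<^sub>R (z - k m)" by blast
  \<comment> \<open>Changing digit \<open>m\<close> alone realises any element of \<open>K m\<close>
    while keeping the earlier digits.\<close>
  define k' where "k' = k(m := z)"
  have k': "k' \<in> PiE UNIV K"
    using k z by (auto simp: k'_def PiE_iff)
  define u where "u = (pt k' - pt k) /\<^sub>R (3 * r m)"
  have ub: "norm (u - b) \<le> 1 / (3 * real (Suc m))"
    using pt_diff_scaled[OF k k', of m] by (simp add: k'_def u_def z(2))
  have "u \<in> cube"
  proof (rule mem_cubeI)
    fix i
    have "\<bar>z $ i\<bar> \<le> 1" "\<bar>k m $ i\<bar> \<le> 1"
      using z k K_subset[of m] by (auto intro!: abs_component_cube_le simp: PiE_iff)
    then have "\<bar>b $ i\<bar> \<le> 2/3" by (simp add: z(2))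
    moreover have "\<bar>u $ i - b $ i\<bar> \<le> 1/3"
    proof -
      have "\<bar>(u - b) $ i\<bar> \<le> norm (u - b)" by (rule component_le_norm_cart)
      also have "\<dots> \<le> 1 / (3 * real (Suc m))" by (rule ub)
      also have "\<dots> \<le> 1/3" by (simp add: field_simps)
      finally show ?thesis by simp
    qed
    ultimately show "\<bar>u $ i\<bar> \<le> 1" by linarith
  qed
  then have "u \<in> magnify (pt k) (3 * r m) X"
    using k' by (auto simp: magnify_def X_def u_def)
  then show "\<exists>a\<in>magnify (pt k) (3 * r m) X. dist a b \<le> 1 / (3 * real (Suc m))"
    using ub by (auto simp: dist_norm)
qed

text \<open>A product of finite sets is compact, and \<open>pt\<close> is continuous on it as a
  uniform limit of finite partial sums.\<close>

lemma compact_X: "compact X"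
  unfolding X_def
proof (rule compact_continuous_image)
  have "compactin (product_topology (\<lambda>_. euclidean) UNIV) (PiE UNIV K)"
    using K_finite by (simp add: compactin_PiE finite_imp_compact)
  then show "compact (PiE UNIV K)"
    by (simp add: euclidean_product_topology)
  have bound: "norm (r n *\<^sub>R k n) \<le> real CARD('n) * r 0 * (1/2) ^ n" if "k \<in> PiE UNIV K" for k n
  proof -
    have "r n * norm (k n) \<le> (r 0 * (1/2) ^ n) * real CARD('n)"
      using r_geometric[of n 0] digit_norm[OF that, of n] r_pos[of 0] by (intro mult_mono) auto
    then show ?thesis using r_pos[of n] by (simp add: mult_ac)
  qed
  have "uniform_limit (PiE UNIV K) (\<lambda>N k. \<Sum>n<N. r n *\<^sub>R k n) (\<lambda>k. \<Sum>n. r n *\<^sub>R k n) sequentially"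
  proof (rule Weierstrass_m_test[OF bound])
    show "summable (\<lambda>n. real CARD('n) * r 0 * (1/2) ^ n)"
      by (rule summable_mult, rule summable_geometric) simp
  qed
  moreover have "continuous_on (PiE UNIV K) (\<lambda>k. \<Sum>n<N. r n *\<^sub>R k n)" for N
    by (intro continuous_intros continuous_on_product_coordinates continuous_on_subset[OF continuous_on_product_coordinates]) auto
  ultimately show "continuous_on (PiE UNIV K) pt"
    unfolding pt_def by (intro uniform_limit_theorem[OF always_eventually]) auto
qed

lemma X_cube_compacts: "X \<in> cube_compacts"
proof -
  have "pt k \<in> cube" if "k \<in> PiE UNIV K" for k
  proof (rule mem_cubeI)
    fix i
    have "norm (pt k) \<le> 2 * real CARD('n) * r 0"
      using tail_bound(2)[OF digit_norm[OF that], of 0] by (simp add: pt_def)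
    with r_0 show "\<bar>pt k $ i\<bar> \<le> 1"
      using component_le_norm_cart[of "pt k" i] by linarith
  qed
  moreover have "PiE UNIV K \<noteq> {}" using K_nonempty by (simp add: PiE_eq_empty_iff)
  ultimately show ?thesis
    using compact_X by (auto simp: cube_compacts_def X_def)
qed

section \<open>Tangent sets at an arbitrary point of the digit set\<close>

text \<open>The digits of \<open>k\<close> are prescribed, so the base point \<open>a\<close> cannot
  be chosen: it arises as a limit of the digits \<open>k n\<close> along indices where
  \<open>K n\<close> approximates \<open>E\<close>.\<close>

lemma tangent_of_dense:
  assumes k: "k \<in> PiE UNIV K" and E: "E \<in> cube_compacts"
    and dense: "\<And>e N. e > 0 \<Longrightarrow> \<exists>n\<ge>N. hausdorff_near e (K n) E"
  obtains a where "a \<in> E" "(\<lambda>z. (1/3) *\<^sub>R (z - a)) ` E \<in> Tan X (pt k)"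
proof -
  have E': "E \<noteq> {}" "compact E" "E \<subseteq> cube" using E by (auto simp: cube_compacts_def)
  have "\<exists>n\<ge>N. hausdorff_near (1 / Suc j) (K n) E" for j N
    by (rule dense) simp
  then obtain m where m: "strict_mono m" "\<And>j. hausdorff_near (1 / Suc j) (K (m j)) E"
    using strict_mono_choice[of "\<lambda>j n. hausdorff_near (1 / Suc j) (K n) E"] by metis
  \<comment> \<open>The digits need not lie in \<open>E\<close>; nearby points of \<open>E\<close>
    replace them so that compactness of \<open>E\<close> applies.\<close>
  have "\<exists>b\<in>E. dist (k (m j)) b \<le> 1 / Suc j" for j
    using m(2)[of j] k unfolding hausdorff_near_def by (auto simp: PiE_iff)
  then obtain b where b: "\<And>j. b j \<in> E" "\<And>j. dist (k (m j)) (b j) \<le> 1 / Suc j" by metis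
  obtain a s where a: "a \<in> E" and s: "strict_mono s" "(b \<circ> s) \<longlonglongrightarrow> a"
    using E'(2) b(1) unfolding compact_def by metis
  define M where "M j = m (s j)" for j
  have M: "strict_mono M" unfolding M_def using m(1) s(1) by (simp add: strict_mono_def)
  define F where "F = (\<lambda>z. (1/3) *\<^sub>R (z - a)) ` E"
  define t where "t j = 3 * r (M j)" for j
  \<comment> \<open>Three errors: magnification against \<open>K (M j)\<close>,
    \<open>K (M j)\<close> against \<open>E\<close>, and base point \<open>k (M j)\<close> against
    \<open>a\<close>.\<close>
  define e where "e j = 1 / (3 * real (Suc (M j))) + (\<bar>1/3\<bar> * (1 / Suc (s j))
      + (1/3) * (1 / Suc (s j) + dist (b (s j)) a))" for j
  have near: "hausdorff_near (e j) (magnify (pt k) (t j) X) F" for j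
  proof -
    have "hausdorff_near ((1/3) * (1 / Suc (s j) + dist (b (s j)) a))
        ((\<lambda>z. (1/3) *\<^sub>R (z - k (M j))) ` E) F"
      unfolding F_def
    proof (rule hausdorff_near_image)
      fix z
      have "dist ((1/3) *\<^sub>R (z - k (M j))) ((1/3) *\<^sub>R (z - a)) = (1/3) * dist (k (M j)) a"
        by (simp add: dist_norm norm_minus_commute flip: scaleR_diff_right)
      also have "dist (k (M j)) a \<le> 1 / Suc (s j) + dist (b (s j)) a"
        using dist_triangle[of "k (M j)" a "b (s j)"] b(2)[of "s j"] by (simp add: M_def)
      finally show "dist ((1/3) *\<^sub>R (z - k (M j))) ((1/3) *\<^sub>R (z - a))
          \<le> (1/3) * (1 / Suc (s j) + dist (b (s j)) a)" by simp
    qed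
    with magnify_near[OF k, of "M j"] hausdorff_near_scale[OF m(2)[of "s j"], of "1/3" "k (M j)"]
    show ?thesis unfolding e_def t_def M_def
      by (blast intro: hausdorff_near_trans)
  qed
  have inv: "(\<lambda>j. 1 / real (Suc (f j))) \<longlonglongrightarrow> 0" if "strict_mono f" for f :: "nat \<Rightarrow> nat"
    using LIMSEQ_subseq_LIMSEQ[OF LIMSEQ_Suc[OF lim_1_over_n] that] by (simp add: o_def)
  have "(\<lambda>j. dist (b (s j)) a) \<longlonglongrightarrow> 0"
    using iffD1[OF tendsto_dist_iff s(2)] by (simp add: o_def)
  from tendsto_add[OF tendsto_mult_right_zero[OF inv[OF M], of "1/3"] tendsto_add[OF
      tendsto_mult_right_zero[OF inv[OF s(1)], of "1/3"]
      tendsto_mult_right_zero[OF tendsto_add_zero[OF inv[OF s(1)] this], of "1/3"]]]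
  have "e \<longlonglongrightarrow> 0" by (simp add: e_def[abs_def])
  have F: "F \<in> cube_compacts"
    unfolding cube_compacts_def
  proof (intro CollectI conjI)
    show "F \<noteq> {}" using E'(1) by (simp add: F_def)
    show "compact F" unfolding F_def
      by (intro compact_continuous_image E'(2) continuous_intros)
    show "F \<subseteq> cube"
    \<comment> \<open>Simplification clears the factor \<open>1/3\<close>, turning the bound 1 into
      3; the coordinates differ by at most 2.\<close>
    proof (clarsimp simp: F_def intro!: mem_cubeI)
      fix z i assume "z \<in> E"
      then have "\<bar>z $ i\<bar> \<le> 1" "\<bar>a $ i\<bar> \<le> 1"
        using a E'(3) by (auto intro: abs_component_cube_le)
      then show "\<bar>z $ i - a $ i\<bar> \<le> 3" by linarith
    qed
  qed
  have ne: "magnify (pt k) (t j) X \<noteq> {}" for j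
    using near[of j] \<open>F \<in> cube_compacts\<close> unfolding hausdorff_near_def cube_compacts_def by blast
  have "(\<lambda>j. hausdorff_dist (magnify (pt k) (t j) X) F) \<longlonglongrightarrow> 0"
    using hausdorff_dist_near[OF near ne] F
    by (intro tendsto_sandwich[OF _ _ tendsto_const \<open>e \<longlonglongrightarrow> 0\<close>]) (auto simp: cube_compacts_def)
  moreover have "t j > 0" for j using r_pos by (simp add: t_def)
  moreover have "decseq t"
    using r_decseq M by (auto simp: t_def decseq_def strict_mono_less_eq)
  moreover have "t \<longlonglongrightarrow> 0"
    using LIMSEQ_subseq_LIMSEQ[OF r_tendsto M] unfolding t_def o_def
    by (rule tendsto_mult_right_zero)
  ultimately have "F \<in> Tan X (pt k)" using F by (auto simp: Tan_def)
  with a show thesis using that by (simp add: F_def)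
qed

end

section \<open>Choice of scales and digit sets\<close>

lemma fast_scales:
  fixes d :: "nat \<Rightarrow> real"
  assumes "C > 0" "\<And>n. d n > 0"
  obtains r :: "nat \<Rightarrow> real" where "\<And>n. r n > 0" "2 * C * r 0 \<le> 1"
    "\<And>n. 4 * C * real (Suc n) * r (Suc n) \<le> r n" "\<And>n. 8 * C * r (Suc n) \<le> r n * d n"
proof -
  \<comment> \<open>Both growth conditions bound the ratio \<open>r (Suc n) / r n\<close>, so each
    step multiplies by the smaller bound.\<close>
  define r where "r = rec_nat (1 / (2 * C)) (\<lambda>n x. x * min (1 / (4 * C * Suc n)) (d n / (8 * C)))"
  have r: "r 0 = 1 / (2 * C)" "\<And>n. r (Suc n) = r n * min (1 / (4 * C * Suc n)) (d n / (8 * C))"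
    by (auto simp: r_def)
  have pos: "r n > 0" for n
    by (induction n) (use assms in \<open>auto simp: r\<close>)
  have a: "r (Suc n) \<le> r n * (1 / (4 * C * Suc n))" "r (Suc n) \<le> r n * (d n / (8 * C))" for n
    unfolding r by (intro mult_left_mono; use pos[of n] in simp)+
  show thesis
  proof (rule that)
    show "r n > 0" for n by (rule pos)
    show "2 * C * r 0 \<le> 1" using assms(1) by (simp add: r)
    show "4 * C * real (Suc n) * r (Suc n) \<le> r n" for n
      using a(1)[of n] assms(1) by (simp add: field_simps del: of_nat_Suc)
    show "8 * C * r (Suc n) \<le> r n * d n" for n
      using a(2)[of n] assms(1) by (simp add: field_simps)
  qed
qed

lemma finite_gap:
  fixes A :: "'a::real_normed_vector set"
  assumes "finite A"
  obtains d where "d > 0" "\<And>a b. \<lbrakk>a \<in> A; b \<in> A; a \<noteq> b\<rbrakk> \<Longrightarrow> d \<le> norm (a - b)"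
proof -
  \<comment> \<open>The element 1 keeps \<open>D\<close> nonempty when \<open>A\<close> has at most
    one point.\<close>
  define D where "D = insert 1 ((\<lambda>(a, b). norm (a - b)) ` (A \<times> A - Id))"
  have fin: "finite D" unfolding D_def
    using assms by simp
  show thesis
  proof
    show "Min D > 0" using fin by (subst Min_gr_iff) (auto simp: D_def)
    show "Min D \<le> norm (a - b)" if "a \<in> A" "b \<in> A" "a \<noteq> b" for a b
      using that by (intro Min_le fin) (auto simp: D_def)
  qed
qed

lemma dense_finite_sets:
  obtains K :: "nat \<Rightarrow> (real ^ 'n) set" where
    "\<And>n. finite (K n)" "\<And>n. K n \<noteq> {}" "\<And>n. K n \<subseteq> cube"
    "\<And>E e N. \<lbrakk>E \<in> cube_compacts; e > 0\<rbrakk> \<Longrightarrow> \<exists>n\<ge>N. hausdorff_near e (K n) E"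
proof -
  obtain T :: "(real ^ 'n) set" where T: "countable T" "T \<subseteq> cube" "cube \<subseteq> closure T"
    using separable by blast
  define \<F> where "\<F> = Fpow T - {{}}"
  have approx: "\<exists>F\<in>\<F>. hausdorff_near e F E" if E: "E \<in> cube_compacts" and e: "e > 0"
    for E and e :: real
  proof -
    from E T(3) have "compact E" "E \<subseteq> closure T" "E \<noteq> {}"
      by (auto simp: cube_compacts_def)
    then obtain F where "finite F" "F \<subseteq> T" "F \<noteq> {}" "hausdorff_near e F E"
      using finite_hausdorff_approx e by metis
    then show ?thesis by (auto simp: \<F>_def Fpow_def)
  qed
  have "cube \<in> (cube_compacts :: (real ^ 'n) set set)"
    by (auto simp: cube_compacts_def cube_def interval_eq_empty_cart)
  from approx[OF this, of 1] have ne: "\<F> \<noteq> {}" by auto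
  have cnt: "countable \<F>" unfolding \<F>_def using T(1) by (simp add: countable_Fpow)
  \<comment> \<open>Only the first component of the decoded pair selects the set; the second makes
    each set recur at arbitrarily large indices.\<close>
  define K where "K n = from_nat_into \<F> (fst (prod_decode n))" for n
  have K: "K n \<in> \<F>" for n unfolding K_def by (rule from_nat_into[OF ne])
  show thesis
  proof
    show "finite (K n)" "K n \<noteq> {}" "K n \<subseteq> cube" for n
      using K[of n] T(2) by (auto simp: \<F>_def Fpow_def)
    show "\<exists>n\<ge>N. hausdorff_near e (K n) E" if E: "E \<in> cube_compacts" and e: "e > 0" for E e N
    proof -
      obtain F where F: "F \<in> \<F>" "hausdorff_near e F E" using approx[OF E e] by blast
      then have "K (prod_encode (to_nat_on \<F> F, N)) = F"
        using cnt by (simp add: K_def)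
      with F(2) show ?thesis using le_prod_encode_2 by metis
    qed
  qed
qed

theorem theorem3p2:
  shows "\<exists>X \<in> (cube_compacts :: (real ^ 'n) set set). \<forall>x\<in>X. sim_eq (Tan X x) cube_compacts"
proof -
  obtain K :: "nat \<Rightarrow> (real ^ 'n) set" where K: "\<And>n. finite (K n)" "\<And>n. K n \<noteq> {}"
    "\<And>n. K n \<subseteq> cube"
    "\<And>E e N. \<lbrakk>E \<in> cube_compacts; e > 0\<rbrakk> \<Longrightarrow> \<exists>n\<ge>N. hausdorff_near e (K n) E"
    using dense_finite_sets by metis
  have "\<exists>d>0. \<forall>a\<in>K n. \<forall>b\<in>K n. a \<noteq> b \<longrightarrow> d \<le> norm (a - b)" for n
    using finite_gap[OF K(1)] by metis
  then obtain d where d: "\<And>n. d n > 0"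
    "\<And>n a b. \<lbrakk>a \<in> K n; b \<in> K n; a \<noteq> b\<rbrakk> \<Longrightarrow> d n \<le> norm (a - b)" by metis
  obtain r where r: "\<And>n. r n > 0" "2 * real CARD('n) * r 0 \<le> 1"
    "\<And>n. 4 * real CARD('n) * real (Suc n) * r (Suc n) \<le> r n"
    "\<And>n. 8 * real CARD('n) * r (Suc n) \<le> r n * d n"
    using fast_scales[of "real CARD('n)" d] d(1) by auto
  interpret fast_digits K r
  proof
    show "8 * real CARD('n) * r (Suc n) \<le> r n * norm (a - b)"
      if "a \<in> K n" "b \<in> K n" "a \<noteq> b" for a b n
      using r(4)[of n] mult_left_mono[OF d(2)[OF that] less_imp_le[OF r(1)[of n]]] by linarith
  qed (use K r in auto)
  show ?thesis
  proof (intro bexI[OF _ X_cube_compacts] ballI)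
    fix x assume "x \<in> X"
    then obtain k where k: "k \<in> PiE UNIV K" "x = pt k" by (auto simp: X_def)
    have "sim_le (Tan X x) cube_compacts"
      unfolding sim_le_def
    \<comment> \<open>Tangent sets are themselves members of \<open>cube_compacts\<close>, so
      \<open>B = A\<close> with ratio 1 works; \<open>1/2\<close> is just a constant below
      1.\<close>
    proof (intro exI[of _ "1/2"] conjI ballI)
      fix A assume "A \<in> Tan X x"
      then have "A \<in> cube_compacts" by (simp add: Tan_def)
      moreover from this obtain a where "a \<in> A" by (auto simp: cube_compacts_def)
      ultimately show "\<exists>B\<in>cube_compacts. \<exists>l. 1/2 < l \<and> l < inverse (1/2) \<and>
          (\<exists>a\<in>A. \<exists>b\<in>B. (\<lambda>z. l *\<^sub>R (z - a)) ` A = (\<lambda>z. z - b) ` B)"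
        by (intro bexI[of _ A] exI[of _ 1] conjI bexI[of _ a]) auto
    qed simp
    moreover have "sim_le cube_compacts (Tan X x)"
      unfolding sim_le_def
    \<comment> \<open>The ratio is always \<open>1/3\<close>, which lies strictly above
      \<open>1/4\<close>. The point \<open>a\<close> is sent to 0, which serves as base point of the
      tangent set.\<close>
    proof (intro exI[of _ "1/4"] conjI ballI)
      fix E :: "(real ^ 'n) set" assume E: "E \<in> cube_compacts"
      obtain a where a: "a \<in> E" "(\<lambda>z. (1/3) *\<^sub>R (z - a)) ` E \<in> Tan X x"
        using tangent_of_dense[OF k(1) E K(4)[OF E]] k(2) by metis
      have "0 \<in> (\<lambda>z. (1/3) *\<^sub>R (z - a)) ` E" using a(1) by force
      with a show "\<exists>B\<in>Tan X x. \<exists>l. 1/4 < l \<and> l < inverse (1/4) \<and>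
          (\<exists>a\<in>E. \<exists>b\<in>B. (\<lambda>z. l *\<^sub>R (z - a)) ` E = (\<lambda>z. z - b) ` B)"
        by (intro bexI[OF _ a(2)] exI[of _ "1/3"] conjI bexI[OF _ a(1)] bexI[of _ 0]) auto
    qed simp
    ultimately show "sim_eq (Tan X x) cube_compacts" by (simp add: sim_eq_def)
  qed
qed

end
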